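(* There exists an upho poset whose rank-generating function is uncomputable, i.e. the sequence $(|P_k|)_{k\ge 0}$ of rank sizes is not a computable sequence.
   Context: A poset $P$ is ranked if it has a disjoint decomposition $P=P_0\sqcup P_1\sqcup P_2\sqcup\cdots$ such that whenever $x\in P_i$ and $y$ covers $x$, then $y\in P_{i+1}$. It is of finite type if every $P_i$ is finite. Its rank-generating function is $F_P(x)=\sum_{k\ge 0}|P_k|x^k$. For $s\in P$, the principal order filter is $V_{P,s}=\{t\in P: t\ge s\}$. A ranked poset $P$ is upho if it is of finite type and $V_{P,s}\cong P$ for every $s\in P$. *)

theory Defs
  imports "HOL-Library.Disjoint_Sets" "HOL-Computational_Algebra.Formal_Power_Series"
begin

section \<open>Posets with a rank decomposition\<close>

text \<open>A poset is a carrier \<open>P\<close> with a relation \<open>r\<close> such that \<^term>\<open>partial_order_on P r\<close>;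
  \<open>(x, y) \<in> r\<close> means \<open>x \<le> y\<close>.\<close>

definition covers :: "'a set \<Rightarrow> 'a rel \<Rightarrow> 'a \<Rightarrow> 'a \<Rightarrow> bool" where
  "covers P r y x \<longleftrightarrow> x \<in> P \<and> y \<in> P \<and> (x, y) \<in> r \<and> x \<noteq> y \<and>
     \<not> (\<exists>z\<in>P. (x, z) \<in> r \<and> (z, y) \<in> r \<and> z \<noteq> x \<and> z \<noteq> y)"

text \<open>The last two clauses spell out the usual convention that the decomposition is that of a rank
  function: ranks increase strictly along the order, and minimal elements have rank zero.  They
  cannot be left implicit.  The condition on covers is vacuous for a poset without covers, such as
  the nonnegative rationals, which could then be cut into finite levels of arbitrary sizes; and
  without the last clause all levels could be shifted.  With both clauses a poset has at most one
  decomposition (lemma \<open>rank_decomposition_unique\<close>), so that the rank-generating function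
  depends on the poset only.\<close>

definition rank_decomposition :: "'a set \<Rightarrow> 'a rel \<Rightarrow> (nat \<Rightarrow> 'a set) \<Rightarrow> bool" where
  "rank_decomposition P r R \<longleftrightarrow>
     disjoint_family R \<and> (\<Union>k. R k) = P \<and>
     (\<forall>i x y. x \<in> R i \<longrightarrow> covers P r y x \<longrightarrow> y \<in> R (Suc i)) \<and>
     (\<forall>i j x y. x \<in> R i \<longrightarrow> y \<in> R j \<longrightarrow> (x, y) \<in> r \<longrightarrow> x \<noteq> y \<longrightarrow> i < j) \<and>
     (\<forall>x\<in>P. (\<forall>y\<in>P. (y, x) \<in> r \<longrightarrow> y = x) \<longrightarrow> x \<in> R 0)"

definition ranked_poset :: "'a set \<Rightarrow> 'a rel \<Rightarrow> bool" where
  "ranked_poset P r \<longleftrightarrow> partial_order_on P r \<and> (\<exists>R. rank_decomposition P r R)"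

lemma rank_decompositionD:
  assumes "rank_decomposition P r R"
  shows "x \<in> R i \<Longrightarrow> x \<in> P"
    and "x \<in> P \<Longrightarrow> \<exists>i. x \<in> R i"
    and "x \<in> R i \<Longrightarrow> x \<in> R j \<Longrightarrow> i = j"
    and "x \<in> R i \<Longrightarrow> covers P r y x \<Longrightarrow> y \<in> R (Suc i)"
    and "x \<in> R i \<Longrightarrow> y \<in> R j \<Longrightarrow> (x, y) \<in> r \<Longrightarrow> x \<noteq> y \<Longrightarrow> i < j"
    and "x \<in> P \<Longrightarrow> (\<And>y. y \<in> P \<Longrightarrow> (y, x) \<in> r \<Longrightarrow> y = x) \<Longrightarrow> x \<in> R 0"
proof -
  have dis: "disjoint_family R" and un: "(\<Union>k. R k) = P"
    and cov: "\<forall>i x y. x \<in> R i \<longrightarrow> covers P r y x \<longrightarrow> y \<in> R (Suc i)"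
    and str: "\<forall>i j x y. x \<in> R i \<longrightarrow> y \<in> R j \<longrightarrow> (x, y) \<in> r \<longrightarrow> x \<noteq> y \<longrightarrow> i < j"
    and bot: "\<forall>x\<in>P. (\<forall>y\<in>P. (y, x) \<in> r \<longrightarrow> y = x) \<longrightarrow> x \<in> R 0"
    using assms unfolding rank_decomposition_def by simp_all
  show "x \<in> R i \<Longrightarrow> x \<in> P" and "x \<in> P \<Longrightarrow> \<exists>i. x \<in> R i"
    using un by auto
  show "x \<in> R i \<Longrightarrow> x \<in> R j \<Longrightarrow> i = j"
    using disjoint_family_onD[OF dis, of i j] by auto
  show "x \<in> R i \<Longrightarrow> covers P r y x \<Longrightarrow> y \<in> R (Suc i)"
    using cov by simp
  show "x \<in> R i \<Longrightarrow> y \<in> R j \<Longrightarrow> (x, y) \<in> r \<Longrightarrow> x \<noteq> y \<Longrightarrow> i < j"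
    using str by simp
  show "x \<in> P \<Longrightarrow> (\<And>y. y \<in> P \<Longrightarrow> (y, x) \<in> r \<Longrightarrow> y = x) \<Longrightarrow> x \<in> R 0"
    using bot by simp
qed

lemma rank_decomposition_unique:
  assumes R: "rank_decomposition P r R" and S: "rank_decomposition P r S"
  shows "R = S"
proof -
  note RD = rank_decompositionD[OF R] and SD = rank_decompositionD[OF S]
  have sub: "x \<in> S i" if "x \<in> R i" for x i
    using that
  proof (induction i arbitrary: x rule: less_induct)
    case (less i)
    have xP: "x \<in> P" using less.prems by (rule RD(1))
    define J where "J = {j. \<exists>y \<in> R j. (y, x) \<in> r \<and> y \<noteq> x}"
    have J: "j < i" if "j \<in> J" for j
      using that RD(5)[OF _ less.prems] unfolding J_def by auto
    show ?case
    proof (cases "J = {}")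
      case True
      have min: "y = x" if y: "y \<in> P" "(y, x) \<in> r" for y
        using y(2) RD(2)[OF y(1)] True unfolding J_def by auto
      have "i = 0" using less.prems RD(6)[OF xP min] by (rule RD(3))
      then show ?thesis using SD(6)[OF xP min] by simp
    next
      case False
      have finJ: "finite J" using J by (meson finite_nat_set_iff_bounded)
      define m where "m = Max J"
      have mJ: "m \<in> J" and mmax: "\<And>j. j \<in> J \<Longrightarrow> j \<le> m"
        using finJ False by (auto simp: m_def)
      then obtain y where y: "y \<in> R m" "(y, x) \<in> r" "y \<noteq> x" by (auto simp: J_def)
      have yP: "y \<in> P" using y(1) by (rule RD(1))
      have "\<not> (\<exists>z\<in>P. (y, z) \<in> r \<and> (z, x) \<in> r \<and> z \<noteq> y \<and> z \<noteq> x)"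
      proof
        assume "\<exists>z\<in>P. (y, z) \<in> r \<and> (z, x) \<in> r \<and> z \<noteq> y \<and> z \<noteq> x"
        then obtain z where z: "z \<in> P" "(y, z) \<in> r" "(z, x) \<in> r" "z \<noteq> y" "z \<noteq> x" by auto
        obtain k where k: "z \<in> R k" using RD(2)[OF z(1)] by auto
        have "m < k" using RD(5)[OF y(1) k z(2)] z(4) by simp
        moreover have "k \<in> J" using k z unfolding J_def by auto
        ultimately show False using mmax[of k] by simp
      qed
      then have cov: "covers P r x y"
        using y yP xP unfolding covers_def by simp
      have i: "i = Suc m"
        using less.prems RD(4)[OF y(1) cov] by (rule RD(3))
      have "y \<in> S m" using less.IH y(1) i by simp
      then show ?thesis using SD(4)[OF _ cov] i by simp
    qed
  qed
  have "x \<in> R i" if x: "x \<in> S i" for x i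
  proof -
    obtain j where j: "x \<in> R j" using RD(2)[OF SD(1)[OF x]] by auto
    have "i = j" using x sub[OF j] by (rule SD(3))
    then show ?thesis using j by simp
  qed
  with sub show ?thesis by (intro ext set_eqI iffI)
qed

definition rank_level :: "'a set \<Rightarrow> 'a rel \<Rightarrow> nat \<Rightarrow> 'a set" where
  "rank_level P r = (THE R. rank_decomposition P r R)"

lemma rank_level_eq: "rank_decomposition P r R \<Longrightarrow> rank_level P r = R"
  unfolding rank_level_def by (rule the_equality) (auto intro: rank_decomposition_unique)

definition finite_type :: "'a set \<Rightarrow> 'a rel \<Rightarrow> bool" where
  "finite_type P r \<longleftrightarrow> (\<forall>k. finite (rank_level P r k))"

definition rank_gen_fun :: "'a set \<Rightarrow> 'a rel \<Rightarrow> nat fps" where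
  "rank_gen_fun P r = Abs_fps (\<lambda>k. card (rank_level P r k))"

section \<open>Upho posets\<close>

definition principal_filter :: "'a set \<Rightarrow> 'a rel \<Rightarrow> 'a \<Rightarrow> 'a set" where
  "principal_filter P r s = {t \<in> P. (s, t) \<in> r}"

definition poset_isomorphic :: "'a set \<Rightarrow> 'a rel \<Rightarrow> 'b set \<Rightarrow> 'b rel \<Rightarrow> bool" where
  "poset_isomorphic A r B s \<longleftrightarrow>
     (\<exists>f. bij_betw f A B \<and> (\<forall>x\<in>A. \<forall>y\<in>A. (x, y) \<in> r \<longleftrightarrow> (f x, f y) \<in> s))"

text \<open>An upho poset is a countable union of finite levels, hence isomorphic to one whose carrier is a
  set of natural numbers.\<close>

definition upho :: "'a set \<Rightarrow> 'a rel \<Rightarrow> bool" where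
  "upho P r \<longleftrightarrow> ranked_poset P r \<and> finite_type P r \<and>
     (\<forall>s\<in>P. poset_isomorphic (principal_filter P r s) (Restr r (principal_filter P r s)) P r)"

section \<open>Computable sequences\<close>

text \<open>Kleene's partial recursive functions.  Arities are not part of the syntax: one term stands for
  a function of every arity at which it makes sense.  In \<open>PrimRec\<close> the recursion argument comes
  first, and in \<open>Mu\<close> the argument searched for comes first.  The search in \<open>Mu\<close> requires the values
  at all smaller arguments to be defined.\<close>

datatype recf =
    Zero
  | Succ
  | Proj nat
  | Comp recf "recf list"
  | PrimRec recf recf
  | Mu recf

inductive recf_eval :: "recf \<Rightarrow> nat list \<Rightarrow> nat \<Rightarrow> bool" where
  zero: "recf_eval Zero xs 0"
| succ: "recf_eval Succ [x] (Suc x)"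
| proj: "i < length xs \<Longrightarrow> recf_eval (Proj i) xs (xs ! i)"
| comp: "list_all2 (\<lambda>g y. recf_eval g xs y) gs ys \<Longrightarrow> recf_eval f ys z \<Longrightarrow>
     recf_eval (Comp f gs) xs z"
| primrec_0: "recf_eval f xs y \<Longrightarrow> recf_eval (PrimRec f g) (0 # xs) y"
| primrec_Suc: "recf_eval (PrimRec f g) (n # xs) y \<Longrightarrow> recf_eval g (n # y # xs) z \<Longrightarrow>
     recf_eval (PrimRec f g) (Suc n # xs) z"
| mu: "recf_eval f (n # xs) 0 \<Longrightarrow> (\<forall>i<n. \<exists>y>0. recf_eval f (i # xs) y) \<Longrightarrow>
     recf_eval (Mu f) xs n"

inductive_cases recf_eval_elims:
  "recf_eval Zero xs y"
  "recf_eval Succ xs y"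
  "recf_eval (Proj i) xs y"
  "recf_eval (Comp f gs) xs y"
  "recf_eval (PrimRec f g) (0 # xs) y"
  "recf_eval (PrimRec f g) (Suc n # xs) y"
  "recf_eval (Mu f) xs y"

lemma recf_eval_deterministic:
  "recf_eval f xs y \<Longrightarrow> recf_eval f xs z \<Longrightarrow> y = z"
proof (induction arbitrary: z rule: recf_eval.induct)
  case (zero xs)
  then show ?case by (rule recf_eval_elims(1)) simp
next
  case (succ x)
  then show ?case by (rule recf_eval_elims(2)) simp
next
  case (proj i xs)
  from proj.prems show ?case by (rule recf_eval_elims(3)) simp
next
  case (comp xs gs ys f w)
  from comp.prems obtain ys' where
    ys': "list_all2 (\<lambda>g y. recf_eval g xs y) gs ys'" "recf_eval f ys' z"
    by (rule recf_eval_elims(4))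
  have "ys = ys'"
  proof (rule nth_equalityI)
    show len: "length ys = length ys'"
      using list_all2_lengthD[OF comp.IH(1)] list_all2_lengthD[OF ys'(1)] by simp
    fix i assume i: "i < length ys"
    then have "recf_eval (gs ! i) xs (ys' ! i)"
      using list_all2_nthD2[OF ys'(1)] len by simp
    then show "ys ! i = ys' ! i"
      using list_all2_nthD2[OF comp.IH(1) i] by simp
  qed
  with ys'(2) show ?case using comp.IH(2) by simp
next
  case (primrec_0 f xs y g)
  from primrec_0.prems have "recf_eval f xs z" by (rule recf_eval_elims(5))
  then show ?case by (rule primrec_0.IH)
next
  case (primrec_Suc f g n xs y w)
  from primrec_Suc.prems obtain y' where
    y': "recf_eval (PrimRec f g) (n # xs) y'" "recf_eval g (n # y' # xs) z"
    by (rule recf_eval_elims(6))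
  have "y = y'" using y'(1) by (rule primrec_Suc.IH(1))
  with y'(2) show ?case using primrec_Suc.IH(2) by simp
next
  case (mu f n xs)
  from mu.prems have "recf_eval f (z # xs) 0 \<and> (\<forall>i<z. \<exists>y>0. recf_eval f (i # xs) y)"
    by (rule recf_eval_elims(7)) simp
  then have z: "recf_eval f (z # xs) 0" "\<forall>i<z. \<exists>y>0. recf_eval f (i # xs) y"
    by simp_all
  have "\<not> z < n"
  proof
    assume "z < n"
    then obtain y where "y > 0" "\<forall>w. recf_eval f (z # xs) w \<longrightarrow> y = w" using mu.IH(2) by auto
    then show False using z(1) by simp
  qed
  moreover have "\<not> n < z"
  proof
    assume "n < z"
    then obtain y where "y > 0" "recf_eval f (n # xs) y" using z(2) by auto
    then show False using mu.IH(1)[of y] by simp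
  qed
  ultimately show ?case by simp
qed

definition computable :: "(nat \<Rightarrow> nat) \<Rightarrow> bool" where
  "computable f \<longleftrightarrow> (\<exists>p. \<forall>n. recf_eval p [n] (f n))"

end

theory Submission
  imports Defs "HOL-Library.Countable_Set"
begin

text \<open>
  There are only countably many computable sequences, so it is enough to find uncountably many
  rank-generating functions of upho posets.  A left cancellative monoid that is graded by length
  and generated in degree one, with finitely many generators, is upho under left divisibility:
  left multiplication by \<open>s\<close> maps the monoid isomorphically onto the filter of \<open>s\<close>.  For a set \<open>S\<close>
  of natural numbers take the monoid \<open>\<langle>a, b, c | a b\<^sup>n c = b\<^sup>n\<^sup>+\<^sup>1 c (n \<in> S)\<rangle>\<close>.  Orienting the
  relations from left to right, no two left-hand sides overlap, the normal forms are the words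
  without a factor \<open>a b\<^sup>n c\<close>, \<open>n \<in> S\<close>, and left multiplication of a normal form by a letter only
  puts a letter in front of it, which gives left cancellation.  If \<open>n\<close> is the least number on
  which \<open>S\<close> and \<open>T\<close> differ, then their monoids have different numbers of elements of length
  \<open>n + 2\<close>.
\<close>

section \<open>Left divisibility in graded monoids\<close>

locale graded_left_cancellative_monoid =
  fixes M :: "'a set" and mult :: "'a \<Rightarrow> 'a \<Rightarrow> 'a" (infixl "\<odot>" 70)
    and one :: 'a and len :: "'a \<Rightarrow> nat"
  assumes one_closed: "one \<in> M"
    and mult_closed: "x \<in> M \<Longrightarrow> y \<in> M \<Longrightarrow> x \<odot> y \<in> M"
    and assoc: "x \<in> M \<Longrightarrow> y \<in> M \<Longrightarrow> z \<in> M \<Longrightarrow> (x \<odot> y) \<odot> z = x \<odot> (y \<odot> z)"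
    and left_one: "x \<in> M \<Longrightarrow> one \<odot> x = x"
    and right_one: "x \<in> M \<Longrightarrow> x \<odot> one = x"
    and left_cancel: "x \<in> M \<Longrightarrow> y \<in> M \<Longrightarrow> z \<in> M \<Longrightarrow> x \<odot> y = x \<odot> z \<Longrightarrow> y = z"
    and len_mult: "x \<in> M \<Longrightarrow> y \<in> M \<Longrightarrow> len (x \<odot> y) = len x + len y"
    and len_eq_0: "x \<in> M \<Longrightarrow> len x = 0 \<Longrightarrow> x = one"
    and split_atom: "x \<in> M \<Longrightarrow> x \<noteq> one \<Longrightarrow> \<exists>g\<in>M. \<exists>w\<in>M. len g = 1 \<and> x = g \<odot> w"
    and finite_len: "finite {x \<in> M. len x = k}"
begin

definition left_dvd :: "'a rel" where
  "left_dvd = {(x, y). x \<in> M \<and> y \<in> M \<and> (\<exists>w\<in>M. y = x \<odot> w)}"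

lemma left_dvd_mult: "x \<in> M \<Longrightarrow> w \<in> M \<Longrightarrow> (x, x \<odot> w) \<in> left_dvd"
  by (auto simp: left_dvd_def mult_closed)

lemma left_dvdE:
  assumes "(x, y) \<in> left_dvd"
  obtains w where "x \<in> M" "w \<in> M" "y = x \<odot> w"
  using assms by (auto simp: left_dvd_def)

lemma len_one: "len one = 0"
  using len_mult[OF one_closed one_closed] left_one[OF one_closed] by simp

text \<open>A cofactor of length 0 is \<open>one\<close>. This strictness yields antisymmetry and
  the strict growth of ranks.\<close>

lemma left_dvd_len_less:
  assumes "(x, y) \<in> left_dvd" "x \<noteq> y"
  shows "len x < len y"
proof -
  obtain w where w: "x \<in> M" "w \<in> M" "y = x \<odot> w" using assms(1) by (rule left_dvdE)
  have "len w \<noteq> 0" using len_eq_0[OF w(2)] right_one[OF w(1)] w(3) assms(2) by metis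
  then show ?thesis using len_mult[OF w(1,2)] w(3) by simp
qed

lemma partial_order_left_dvd: "partial_order_on M left_dvd"
proof -
  have "left_dvd \<subseteq> M \<times> M" by (auto simp: left_dvd_def)
  moreover have "refl_on M left_dvd"
    using left_dvd_mult[OF _ one_closed] by (auto simp: refl_on_def left_dvd_def right_one)
  moreover have "trans left_dvd"
  proof (rule transI)
    fix x y z assume "(x, y) \<in> left_dvd" "(y, z) \<in> left_dvd"
    then obtain v w where "x \<in> M" "v \<in> M" "y = x \<odot> v" "w \<in> M" "z = y \<odot> w"
      by (metis left_dvdE)
    then show "(x, z) \<in> left_dvd"
      using left_dvd_mult[of x "v \<odot> w"] by (simp add: assoc mult_closed)
  qed
  moreover have "antisym left_dvd"
    by (rule antisymI) (metis left_dvd_len_less less_asym)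
  ultimately show ?thesis
    by (simp add: partial_order_on_def preorder_on_def)
qed

lemma rank_decomposition_left_dvd: "rank_decomposition M left_dvd (\<lambda>k. {x \<in> M. len x = k})"
  unfolding rank_decomposition_def
proof (intro conjI allI impI ballI)
  show "disjoint_family (\<lambda>k. {x \<in> M. len x = k})"
    by (auto simp: disjoint_family_on_def)
  show "(\<Union>k. {x \<in> M. len x = k}) = M" by auto
  show "y \<in> {x \<in> M. len x = Suc i}"
    if "x \<in> {x \<in> M. len x = i}" and c: "covers M left_dvd y x" for i x y
  proof -
    have x: "x \<in> M" "len x = i" using that(1) by auto
    from c have yM: "y \<in> M" and "(x, y) \<in> left_dvd" and ne: "x \<noteq> y"
      and between: "\<And>z. z \<in> M \<Longrightarrow> (x, z) \<in> left_dvd \<Longrightarrow> (z, y) \<in> left_dvd \<Longrightarrow> z = x \<or> z = y"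
      by (auto simp: covers_def)
    then obtain w where w: "w \<in> M" "y = x \<odot> w" by (metis left_dvdE)
    \<comment> \<open>Split an atom \<open>g\<close> off the cofactor: \<open>x \<odot> g\<close>
      lies between \<open>x\<close> and \<open>y\<close> and is longer than \<open>x\<close>, so the
      cover is \<open>x \<odot> g\<close> itself.\<close>
    have "w \<noteq> one" using w ne right_one x by auto
    then obtain g v where g: "g \<in> M" "v \<in> M" "len g = 1" "w = g \<odot> v"
      using split_atom[OF w(1)] by auto
    have xg: "x \<odot> g \<in> M" "len (x \<odot> g) = Suc i"
      using x g by (simp_all add: mult_closed len_mult)
    have "y = (x \<odot> g) \<odot> v" using w g x by (simp add: assoc)
    then have "x \<odot> g = x \<or> x \<odot> g = y"
      using between[OF xg(1) left_dvd_mult[OF x(1) g(1)]] left_dvd_mult[OF xg(1) g(2)] by simp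
    then show ?thesis using xg x by auto
  qed
  show "i < j" if "x \<in> {x \<in> M. len x = i}" "y \<in> {x \<in> M. len x = j}" "(x, y) \<in> left_dvd" "x \<noteq> y"
    for i j x y
    using that left_dvd_len_less by auto
  \<comment> \<open>\<open>one\<close> divides everything, so a minimal element equals it.\<close>
  show "x \<in> {x \<in> M. len x = 0}" if "x \<in> M" "\<forall>y\<in>M. (y, x) \<in> left_dvd \<longrightarrow> y = x" for x
    using that left_dvd_mult[OF one_closed that(1)] left_one one_closed len_one by auto
qed

lemma filter_isomorphic:
  assumes s: "s \<in> M"
  shows "poset_isomorphic (principal_filter M left_dvd s)
    (Restr left_dvd (principal_filter M left_dvd s)) M left_dvd"
proof -
  have inj: "inj_on ((\<odot>) s) M" using left_cancel s by (auto intro: inj_onI)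
  have img: "(\<odot>) s ` M = principal_filter M left_dvd s"
    using s by (auto simp: principal_filter_def left_dvd_def mult_closed)
  have bij: "bij_betw ((\<odot>) s) M (principal_filter M left_dvd s)"
    using inj img by (simp add: bij_betw_def)
  \<comment> \<open>Cancelling \<open>s\<close> reflects divisibility, associativity preserves
    it.\<close>
  have eq: "(s \<odot> u, s \<odot> v) \<in> left_dvd \<longleftrightarrow> (u, v) \<in> left_dvd" if u: "u \<in> M" and v: "v \<in> M" for u v
  proof
    assume "(s \<odot> u, s \<odot> v) \<in> left_dvd"
    then obtain w where w: "w \<in> M" "s \<odot> v = (s \<odot> u) \<odot> w" by (metis left_dvdE)
    then have "s \<odot> v = s \<odot> (u \<odot> w)" using s u by (simp add: assoc)
    then have "v = u \<odot> w" by (rule left_cancel[OF s v mult_closed[OF u w(1)]])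
    then show "(u, v) \<in> left_dvd" using left_dvd_mult[OF u w(1)] by simp
  next
    assume "(u, v) \<in> left_dvd"
    then obtain w where w: "w \<in> M" "v = u \<odot> w" by (metis left_dvdE)
    then show "(s \<odot> u, s \<odot> v) \<in> left_dvd"
      using left_dvd_mult[OF mult_closed[OF s u] w(1)] s u by (simp add: assoc)
  qed
  show ?thesis
    unfolding poset_isomorphic_def
  proof (intro exI conjI ballI)
    let ?f = "the_inv_into M ((\<odot>) s)"
    show "bij_betw ?f (principal_filter M left_dvd s) M"
      using bij by (rule bij_betw_the_inv_into)
    fix x y assume xy: "x \<in> principal_filter M left_dvd s" "y \<in> principal_filter M left_dvd s"
    then obtain u v where uv: "u \<in> M" "v \<in> M" "x = s \<odot> u" "y = s \<odot> v" by (auto simp flip: img)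
    have "?f x = u" "?f y = v" using uv the_inv_into_f_f[OF inj] by auto
    then show "(x, y) \<in> Restr left_dvd (principal_filter M left_dvd s) \<longleftrightarrow>
        (?f x, ?f y) \<in> left_dvd"
      using eq[OF uv(1,2)] uv(3,4) xy by simp
  qed
qed

lemma rank_level_left_dvd: "rank_level M left_dvd k = {x \<in> M. len x = k}"
  using rank_level_eq[OF rank_decomposition_left_dvd] by simp

lemma upho_left_dvd: "upho M left_dvd"
  unfolding upho_def ranked_poset_def finite_type_def
  using partial_order_left_dvd rank_decomposition_left_dvd filter_isomorphic
  by (auto simp: rank_level_left_dvd finite_len)

end

section \<open>A family of monoids indexed by sets of natural numbers\<close>

datatype letter = A | B | C

instance letter :: countable by countable_datatype

lemma finite_UNIV_letter: "finite (UNIV :: letter set)"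
proof -
  have "x \<in> {A, B, C}" for x by (cases x) simp_all
  then show ?thesis by (intro finite_subset[of UNIV "{A, B, C}"]) auto
qed

text \<open>Describes the tails before which an \<open>A\<close> would start a left-hand side of a
  rule.\<close>

definition reducible :: "nat set \<Rightarrow> letter list \<Rightarrow> bool" where
  "reducible S v \<longleftrightarrow> (\<exists>n\<in>S. \<exists>w. v = replicate n B @ C # w)"

text \<open>Left multiplication of a normal form by a letter. A rule changes only its leading
  \<open>A\<close> to \<open>B\<close>, and no rule starts with \<open>B\<close>, so one rewriting
  step suffices.\<close>

definition push :: "nat set \<Rightarrow> letter \<Rightarrow> letter list \<Rightarrow> letter list" where
  "push S x v = (if x = A \<and> reducible S v then B else x) # v"

definition wmult :: "nat set \<Rightarrow> letter list \<Rightarrow> letter list \<Rightarrow> letter list" where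
  "wmult S u v = foldr (push S) u v"

fun normal :: "nat set \<Rightarrow> letter list \<Rightarrow> bool" where
  "normal S [] \<longleftrightarrow> True"
| "normal S (x # v) \<longleftrightarrow> normal S v \<and> \<not> (x = A \<and> reducible S v)"

section \<open>The monoid of normal forms\<close>

lemma wmult_simps [simp]:
  "wmult S [] v = v"
  "wmult S (x # u) v = push S x (wmult S u v)"
  by (simp_all add: wmult_def)

lemma normal_push: "normal S v \<Longrightarrow> normal S (push S x v)"
  by (auto simp: push_def)

lemma normal_wmult: "normal S v \<Longrightarrow> normal S (wmult S u v)"
  by (induction u) (auto intro: normal_push)

lemma wmult_Nil: "normal S u \<Longrightarrow> wmult S u [] = u"
  by (induction u) (auto simp: push_def)

lemma length_wmult: "length (wmult S u v) = length u + length v"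
  by (induction u) (auto simp: push_def)

text \<open>Each \<open>push\<close> keeps its argument as the tail, so it is injective.\<close>

lemma wmult_left_cancel: "wmult S u v = wmult S u w \<Longrightarrow> v = w"
  by (induction u) (auto simp: push_def)

lemma wmult_replicate_B: "wmult S (replicate n B @ C # u) v = replicate n B @ C # wmult S u v"
  by (induction n) (auto simp: push_def)

lemma reducible_wmult: "reducible S u \<Longrightarrow> reducible S (wmult S u v)"
  unfolding reducible_def using wmult_replicate_B by metis

text \<open>The key to associativity. If \<open>A\<close> is rewritten in front of \<open>u\<close>,
  the responsible prefix of \<open>u\<close> survives right multiplication, because
  \<open>push\<close> never alters \<open>B\<close> or \<open>C\<close>; so \<open>A\<close> is
  rewritten on both sides. Otherwise \<open>push\<close> merely prepends \<open>x\<close>.\<close>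

lemma wmult_push: "wmult S (push S x u) v = push S x (wmult S u v)"
  using reducible_wmult[of S u v] by (auto simp: push_def)

lemma wmult_assoc: "wmult S (wmult S u v) w = wmult S u (wmult S v w)"
  by (induction u) (simp_all add: wmult_push)

text \<open>Words are coded as numbers to obtain a poset whose carrier is a set of naturals.\<close>

definition nf_codes :: "nat set \<Rightarrow> nat set" where
  "nf_codes S = to_nat ` {w. normal S w}"

lemma nf_codesD: "x \<in> nf_codes S \<Longrightarrow> normal S (from_nat x) \<and> to_nat (from_nat x :: letter list) = x"
  by (auto simp: nf_codes_def)

lemma to_nat_in_nf_codes [simp]: "to_nat w \<in> nf_codes S \<longleftrightarrow> normal S w"
  by (auto simp: nf_codes_def)

lemma nf_codes_length:
  "{x \<in> nf_codes S. length (from_nat x :: letter list) = k} = to_nat ` {w. normal S w \<and> length w = k}"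
  by (auto simp: nf_codes_def)

lemma finite_normal_length: "finite {w. normal S w \<and> length w = k}"
  using finite_lists_length_eq[OF finite_UNIV_letter, of k] by (rule rev_finite_subset) auto

interpretation nf: graded_left_cancellative_monoid "nf_codes S"
  "\<lambda>x y. to_nat (wmult S (from_nat x) (from_nat y))" "to_nat ([] :: letter list)"
  "\<lambda>x. length (from_nat x :: letter list)" for S
proof
  fix x assume *: "x \<in> nf_codes S"
  note x = nf_codesD[OF *]
  show "to_nat (wmult S (from_nat (to_nat ([] :: letter list))) (from_nat x)) = x"
    using x by simp
  show "to_nat (wmult S (from_nat x) (from_nat (to_nat ([] :: letter list)))) = x"
    using x by (simp add: wmult_Nil)
  show "x = to_nat ([] :: letter list)" if "length (from_nat x :: letter list) = 0"
    using x that by simp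
  show "\<exists>g\<in>nf_codes S. \<exists>w\<in>nf_codes S.
      length (from_nat g :: letter list) = 1 \<and> x = to_nat (wmult S (from_nat g) (from_nat w))"
    if ne: "x \<noteq> to_nat ([] :: letter list)"
  proof -
    obtain l v where lv: "from_nat x = l # (v :: letter list)"
      using ne x by (cases "from_nat x :: letter list") auto
    \<comment> \<open>The atom is the first letter; as \<open>l # v\<close> is normal, pushing
      \<open>l\<close> back onto \<open>v\<close> rewrites nothing.\<close>
    have "normal S [l]" by (simp add: reducible_def)
    moreover have "normal S v" "push S l v = l # v" using x lv by (auto simp: push_def)
    moreover have "x = to_nat (l # v)" using x lv by simp
    ultimately have "normal S [l]" "normal S v" "x = to_nat (push S l v)" by simp_all
    then show ?thesis
      by (intro bexI[of _ "to_nat [l]"] bexI[of _ "to_nat v"]) simp_all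
  qed
  fix y assume **: "y \<in> nf_codes S"
  note y = nf_codesD[OF **]
  show "to_nat (wmult S (from_nat x) (from_nat y)) \<in> nf_codes S"
    using y by (simp add: normal_wmult)
  show "length (from_nat (to_nat (wmult S (from_nat x) (from_nat y))) :: letter list) =
      length (from_nat x :: letter list) + length (from_nat y :: letter list)"
    by (simp add: length_wmult)
  fix z assume ***: "z \<in> nf_codes S"
  note z = nf_codesD[OF ***]
  show "y = z"
    if "to_nat (wmult S (from_nat x) (from_nat y)) = to_nat (wmult S (from_nat x) (from_nat z))"
  proof -
    have "wmult S (from_nat x) (from_nat y) = wmult S (from_nat x) (from_nat z)"
      using that by simp
    then have "(from_nat y :: letter list) = from_nat z" by (rule wmult_left_cancel)
    then show ?thesis using y z by metis
  qed
  show "to_nat (wmult S (from_nat (to_nat (wmult S (from_nat x) (from_nat y)))) (from_nat z)) =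
     to_nat (wmult S (from_nat x) (from_nat (to_nat (wmult S (from_nat y) (from_nat z)))))"
    by (simp add: wmult_assoc)
qed (simp_all add: nf_codes_length finite_normal_length)

section \<open>Rank sizes determine the set\<close>

definition nf_order :: "nat set \<Rightarrow> nat rel" where
  "nf_order S = nf.left_dvd S"

definition nf_growth :: "nat set \<Rightarrow> nat \<Rightarrow> nat" where
  "nf_growth S k = card {w. normal S w \<and> length w = k}"

lemma rank_gen_fun_nf: "fps_nth (rank_gen_fun (nf_codes S) (nf_order S)) k = nf_growth S k"
  by (simp add: rank_gen_fun_def nf_order_def nf.rank_level_left_dvd nf_codes_length
      nf_growth_def card_image)

text \<open>The number of letters \<open>B\<close> before the first \<open>C\<close> can be read off
  the word.\<close>

lemma reducible_replicate_B: "reducible S (replicate n B @ C # w) \<longleftrightarrow> n \<in> S"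
proof -
  have "m = n" if "replicate n B @ C # w = replicate m B @ C # w'" for m w'
    using that
  proof (induction n arbitrary: m)
    case 0 then show ?case by (cases m) auto
  next
    case (Suc n) then show ?case by (cases m) auto
  qed
  then show ?thesis unfolding reducible_def by blast
qed

text \<open>A forbidden factor with exponent \<open>m\<close> has length \<open>m + 2\<close>. In
  words this short only \<open>m \<le> n\<close> can occur, and \<open>n\<close> is not in
  \<open>T\<close>, so every factor forbidden by \<open>T\<close> is forbidden by
  \<open>S\<close>.\<close>

lemma normal_antimono:
  assumes "\<And>m. m < n \<Longrightarrow> m \<in> T \<Longrightarrow> m \<in> S" "n \<notin> T" "length w \<le> n + 2" "normal S w"
  shows "normal T w"
  using assms(3,4)
proof (induction w)
  case (Cons x w)
  have "reducible S w" if red: "reducible T w"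
  proof -
    obtain m v where m: "m \<in> T" "w = replicate m B @ C # v" using red by (auto simp: reducible_def)
    then have "m < n" using Cons.prems(1) assms(2) by (cases "m = n") auto
    then show ?thesis using m assms(1) by (auto simp: reducible_def)
  qed
  then show ?case using Cons by auto
qed simp

lemma nf_growth_less:
  assumes "\<And>m. m < n \<Longrightarrow> m \<in> S \<longleftrightarrow> m \<in> T" "n \<in> S" "n \<notin> T"
  shows "nf_growth S (n + 2) < nf_growth T (n + 2)"
  unfolding nf_growth_def
proof (rule psubset_card_mono[OF finite_normal_length])
  \<comment> \<open>The left-hand side of the rule for \<open>n\<close> makes the inclusion
    strict.\<close>
  let ?w = "A # replicate n B @ [C]"
  have "normal T (replicate k B @ [C])" for k by (induction k) (auto simp: reducible_def)
  then have "normal T ?w" "\<not> normal S ?w"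
    using assms(2,3) by (simp_all add: reducible_replicate_B)
  moreover have "length ?w = n + 2" by simp
  moreover have "{w. normal S w \<and> length w = n + 2} \<subseteq> {w. normal T w \<and> length w = n + 2}"
    using normal_antimono[of n T S] assms by auto
  ultimately show "{w. normal S w \<and> length w = n + 2} \<subset> {w. normal T w \<and> length w = n + 2}"
    by blast
qed

lemma inj_nf_growth: "inj nf_growth"
proof (rule injI, rule ccontr)
  fix S T assume eq: "nf_growth S = nf_growth T" and "S \<noteq> T"
  then have ex: "\<exists>n. (n \<in> S) \<noteq> (n \<in> T)" by auto
  define n where "n = (LEAST n. (n \<in> S) \<noteq> (n \<in> T))"
  have n: "(n \<in> S) \<noteq> (n \<in> T)" unfolding n_def using ex by (rule LeastI_ex)
  have below: "m \<in> S \<longleftrightarrow> m \<in> T" if "m < n" for m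
    using not_less_Least that unfolding n_def by blast
  show False
    \<comment> \<open>Whichever set contains \<open>n\<close> has fewer normal words of length
      \<open>n + 2\<close>.\<close>
    using nf_growth_less[of n S T] nf_growth_less[of n T S] n below eq by auto
qed

section \<open>Counting computable sequences\<close>

instance recf :: countable by countable_datatype

text \<open>By determinism a program determines the sequence it computes; \<open>THE\<close> gives
  arbitrary values where a program diverges, which only enlarges the range.\<close>

lemma countable_computable: "countable {f. computable f}"
proof (rule countable_subset)
  show "{f. computable f} \<subseteq> range (\<lambda>p n. THE y. recf_eval p [n] y)"
  proof
    fix f assume "f \<in> {f. computable f}"
    then obtain p where p: "\<And>n. recf_eval p [n] (f n)" by (auto simp: computable_def)
    have "f = (\<lambda>n. THE y. recf_eval p [n] y)"
      using p recf_eval_deterministic by (intro ext the_equality[symmetric]) blast+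
    then show "f \<in> range (\<lambda>p n. THE y. recf_eval p [n] y)" by blast
  qed
qed simp

lemma uncountable_nat_sets: "\<not> countable (UNIV :: nat set set)"
proof
  assume "countable (UNIV :: nat set set)"
  then have "range (from_nat_into (UNIV :: nat set set)) = Pow UNIV"
    by (simp add: range_from_nat_into)
  then show False using Cantors_theorem by blast
qed

theorem theorem1p5:
  "\<exists>(P :: nat set) (r :: nat rel).
     upho P r \<and> \<not> computable (\<lambda>k. fps_nth (rank_gen_fun P r) k)"
proof -
  \<comment> \<open>Otherwise the injection \<open>nf_growth\<close> would make the sets of naturals
    countable.\<close>
  have "\<not> range nf_growth \<subseteq> {f. computable f}"
    using countable_subset[OF _ countable_computable] countable_image_inj_on[OF _ inj_nf_growth]
      uncountable_nat_sets by blast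
  then obtain S where "\<not> computable (nf_growth S)" by auto
  moreover have "upho (nf_codes S) (nf_order S)"
    unfolding nf_order_def by (rule nf.upho_left_dvd)
  ultimately show ?thesis
    by (intro exI[of _ "nf_codes S"] exI[of _ "nf_order S"]) (simp add: rank_gen_fun_nf)
qed

end
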